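(* Let $c$ be a crown and $\lambda=(c+2)/2$. The odd skeleton $\mathcal{L}_\lambda$ consists of exactly the integers $$\mathcal{L}_\lambda=\{\lambda\cdot 2^a\cdot 3^b-1 : a\ge 1,\ b\ge 0\}.$$ Moreover, the element $\lambda\cdot 2^a\cdot 3^b-1$ at position $(a,b)$ lies in row $k=a+b$ of $\mathcal{T}_c$.
   Context: A nonnegative integer $c$ is a crown if $c\equiv 0$ or $8\pmod{12}$. For a crown $c$ put $\lambda=(c+2)/2$. For integers $k\ge 0$ and $0\le j\le 2k$ define $R(k,j)=2^{k-\lfloor j/2\rfloor}\cdot 3^{\lfloor j/2\rfloor}$. Let $g(j)=2$ if $j$ is even and $g(j)=1$ if $j$ is odd. The crown triangle $\mathcal{T}_c$ has the element $\mathcal{T}_c(k,j)=g(j)\,(\lambda R(k,j)-1)$ at position $(k,j)$; row $k$ consists of the positions $j=0,1,\dots,2k$. The odd skeleton $\mathcal{L}_\lambda$ is the set of odd elements of $\mathcal{T}_c$, where $\lambda=(c+2)/2$. Its elements $n$ are indexed by coordinates $(a,b)$, where $a$ is the exponent of $2$ and $b$ the exponent of $3$ in the factorization $n+1=\lambda\cdot 2^a\cdot 3^b$. The exponents $a,b$ are integers. *)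

theory Defs
  imports "HOL-Number_Theory.Cong"
begin

definition crown :: "int \<Rightarrow> bool" where
  "crown c \<longleftrightarrow> c \<ge> 0 \<and> ([c = 0] (mod 12) \<or> [c = 8] (mod 12))"

(* The division is exact: every crown is even. *)
definition crown_lambda :: "int \<Rightarrow> int" where
  "crown_lambda c = (c + 2) div 2"

(* Only used for j \<le> 2 * k, where the subtraction on nat does not truncate. *)
definition R :: "nat \<Rightarrow> nat \<Rightarrow> int" where
  "R k j = 2 ^ (k - j div 2) * 3 ^ (j div 2)"

definition g :: "nat \<Rightarrow> int" where
  "g j = (if even j then 2 else 1)"

definition crown_triangle :: "int \<Rightarrow> nat \<Rightarrow> nat \<Rightarrow> int" where
  "crown_triangle c k j = g j * (crown_lambda c * R k j - 1)"

definition triangle_row :: "int \<Rightarrow> nat \<Rightarrow> int set" where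
  "triangle_row c k = {crown_triangle c k j | j. j \<le> 2 * k}"

definition triangle_elements :: "int \<Rightarrow> int set" where
  "triangle_elements c = (\<Union>k. triangle_row c k)"

(* Indexed by c rather than by lambda; the two determine each other, c = 2 * lambda - 2. *)
definition odd_skeleton :: "int \<Rightarrow> int set" where
  "odd_skeleton c = {n \<in> triangle_elements c. odd n}"

definition skeleton_position :: "int \<Rightarrow> int \<Rightarrow> nat \<Rightarrow> nat \<Rightarrow> bool" where
  "skeleton_position c n a b \<longleftrightarrow>
     n \<in> odd_skeleton c \<and> n + 1 = crown_lambda c * 2 ^ a * 3 ^ b"

end

theory Submission
  imports Defs
begin

text \<open>
  The factor \<open>g j\<close> makes every element in an even column even. An odd column of row \<open>k\<close> is
  \<open>j = 2 * b + 1\<close> with \<open>b < k\<close>, because the row ends at the even column \<open>2 * k\<close>; there \<open>g j = 1\<close>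
  and the power of \<open>2\<close> in \<open>R k j\<close> has the exponent \<open>a = k - b \<ge> 1\<close>. So the element
  \<open>\<lambda> * 2 ^ a * 3 ^ b - 1\<close> is one less than an even number, and the odd elements are exactly those
  in odd columns. The map \<open>(k, b) \<mapsto> (k - b, b)\<close> identifies these positions with the pairs
  \<open>a \<ge> 1\<close>, \<open>b \<ge> 0\<close>, and its inverse gives the row \<open>k = a + b\<close>.
\<close>

lemma crown_triangle_odd_column:
  "crown_triangle c (a + b) (2 * b + 1) = crown_lambda c * 2 ^ a * 3 ^ b - 1"
  by (simp add: crown_triangle_def R_def g_def)

lemma odd_times_power_two_minus_one:
  fixes x y :: int
  assumes "a \<ge> 1"
  shows "odd (x * 2 ^ a * y - 1)"
  using assms by simp

lemma skeleton_element_in_row: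
  assumes "a \<ge> 1"
  shows "crown_lambda c * 2 ^ a * 3 ^ b - 1 \<in> triangle_row c (a + b)"
proof -
  have "2 * b + 1 \<le> 2 * (a + b)"
    using assms by simp
  then show ?thesis
    unfolding triangle_row_def using crown_triangle_odd_column[of c a b]
    by (metis (mono_tags, lifting) mem_Collect_eq)
qed

lemma odd_skeleton_coordinates:
  assumes "n \<in> odd_skeleton c"
  obtains a b where "a \<ge> 1" and "n = crown_lambda c * 2 ^ a * 3 ^ b - 1"
proof -
  from assms obtain k j where j: "j \<le> 2 * k" and n: "n = crown_triangle c k j" and "odd n"
    by (auto simp: odd_skeleton_def triangle_elements_def triangle_row_def)
  then have "odd j"
    by (auto simp: crown_triangle_def g_def split: if_splits)
  then obtain b where b: "j = 2 * b + 1"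
    by (rule oddE)
  \<comment> \<open>The column \<open>j\<close> is odd and the last column \<open>2 * k\<close> is even, so \<open>j < 2 * k\<close>.\<close>
  with j have "b < k"
    by simp
  then have "k - b \<ge> 1" and "k = (k - b) + b"
    by simp_all
  with n b have "n = crown_lambda c * 2 ^ (k - b) * 3 ^ b - 1"
    by (metis crown_triangle_odd_column)
  with \<open>k - b \<ge> 1\<close> show thesis
    by (rule that)
qed

theorem proposition3p3:
  fixes c lam :: int
  assumes "crown c" and "lam = crown_lambda c"
  shows "odd_skeleton c = {lam * 2 ^ a * 3 ^ b - 1 | a b :: nat. a \<ge> 1 \<and> b \<ge> 0} \<and>
    (\<forall>a b :: nat. a \<ge> 1 \<and> b \<ge> 0 \<longrightarrow>
       skeleton_position c (lam * 2 ^ a * 3 ^ b - 1) a b \<and>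
       lam * 2 ^ a * 3 ^ b - 1 \<in> triangle_row c (a + b))"
proof -
  have row: "lam * 2 ^ a * 3 ^ b - 1 \<in> triangle_row c (a + b)" if "a \<ge> 1" for a b
    using skeleton_element_in_row[OF that] assms(2) by simp
  have skeleton: "lam * 2 ^ a * 3 ^ b - 1 \<in> odd_skeleton c" if "a \<ge> 1" for a b
    using row[OF that] odd_times_power_two_minus_one[OF that]
    unfolding odd_skeleton_def triangle_elements_def by blast
  have "odd_skeleton c = {lam * 2 ^ a * 3 ^ b - 1 | a b :: nat. a \<ge> 1 \<and> b \<ge> 0}"
  proof
    show "odd_skeleton c \<subseteq> {lam * 2 ^ a * 3 ^ b - 1 | a b :: nat. a \<ge> 1 \<and> b \<ge> 0}"
      using assms(2) by (auto elim!: odd_skeleton_coordinates)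
    show "{lam * 2 ^ a * 3 ^ b - 1 | a b :: nat. a \<ge> 1 \<and> b \<ge> 0} \<subseteq> odd_skeleton c"
      using skeleton by blast
  qed
  moreover have "skeleton_position c (lam * 2 ^ a * 3 ^ b - 1) a b" if "a \<ge> 1" for a b
    using skeleton[OF that] assms(2) by (simp add: skeleton_position_def)
  ultimately show ?thesis
    using row by blast
qed

end
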